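(* For every integer $n\ge0$, $$f_1(n,o)=\Bigl[\frac{11}{14}-\frac{5}{42}\Bigl(\frac1{15}\Bigr)^n\Bigr]2^{\alpha(n)}3^{\beta(n)}5^{\gamma(n)},\qquad f_2(n,o)=\Bigl[\frac{3}{14}+\frac{5}{42}\Bigl(\frac1{15}\Bigr)^n\Bigr]2^{\alpha(n)}3^{\beta(n)}5^{\gamma(n)},$$ where $\alpha(n)=\frac12(3^n-1)$, $\beta(n)=\frac14(3^{n+1}+2n+1)$ and $\gamma(n)=\frac14(3^n-2n-1)$. Moreover, $$\lim_{n\to\infty}F_1(n,o)=\frac{11}{14},\qquad \lim_{n\to\infty}F_2(n,o)=\frac{3}{14}.$$
   Context: The two-dimensional Sierpinski gasket graph $SG(n)$, $n\ge 0$, is drawn in the plane with three outmost vertices: leftmost $o$, rightmost $a_n$, topmost $b_n$. $SG(0)$ is a triangle (3 vertices, 3 edges). $SG(n+1)$ consists of three copies of $SG(n)$ (lower-left, lower-right, top), where the rightmost vertex of the lower-left copy is identified with the leftmost vertex of the lower-right copy, the topmost vertex of the lower-left copy with the leftmost vertex of the top copy, and the topmost vertex of the lower-right copy with the rightmost vertex of the top copy. $f(n)$ is the number of spanning trees of $SG(n)$, $f_j(n,x)$ is the number of spanning trees of $SG(n)$ in which exactly $j$ tree edges are incident to the vertex $x$, and $F_j(n,x)=f_j(n,x)/f(n)$. *)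

theory Defs
  imports Complex_Main
begin

section \<open>Spanning trees of undirected simple graphs\<close>

text \<open>
  A graph is given by a vertex set V and a set E of two-element subsets of V.
  The AFP entry Graph_Theory is not used: its predicate spanning_tree is about digraphs and only
  excludes directed cycles, so it does not express spanning trees of an undirected graph.
\<close>

definition graph_connected :: "'a set \<Rightarrow> 'a set set \<Rightarrow> bool" where
  "graph_connected V E \<longleftrightarrow>
     V \<noteq> {} \<and> (\<forall>u\<in>V. \<forall>v\<in>V. (u, v) \<in> {(x, y). {x, y} \<in> E}\<^sup>*)"

text \<open>The list of the successive vertices of a cycle; the closing edge joins last to first.\<close>

definition graph_cycle :: "'a set set \<Rightarrow> 'a list \<Rightarrow> bool" where
  "graph_cycle E p \<longleftrightarrow>
     length p \<ge> 3 \<and> distinct p \<and>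
     (\<forall>i < length p. {p ! i, p ! (Suc i mod length p)} \<in> E)"

definition graph_tree :: "'a set \<Rightarrow> 'a set set \<Rightarrow> bool" where
  "graph_tree V E \<longleftrightarrow> graph_connected V E \<and> (\<nexists>p. graph_cycle E p)"

text \<open>A spanning tree has vertex set V, so it is identified with its edge set.\<close>

definition spanning_trees :: "'a set \<Rightarrow> 'a set set \<Rightarrow> 'a set set set" where
  "spanning_trees V E = {T. T \<subseteq> E \<and> graph_tree V T}"

definition degree_in :: "'a set set \<Rightarrow> 'a \<Rightarrow> nat" where
  "degree_in T x = card {e \<in> T. x \<in> e}"

section \<open>The Sierpinski gasket graphs\<close>

text \<open>
  The pair (i, j) is the point i (1, 0) + j (1/2, sqrt 3 / 2) of the plane. In these coordinates
  SG(n) is drawn with edges of length 1 and outmost vertices o, a(n) (rightmost) and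
  b(n) (topmost). The lower-right and top copies of SG(n) inside SG(n + 1) are the translates
  of the lower-left one by a(n) and b(n); the three identifications then hold by equality
  of points, and the lemmas below state that nothing else is identified.
\<close>

type_synonym point = "nat \<times> nat"

definition SG_o :: point where "SG_o = (0, 0)"
definition SG_a :: "nat \<Rightarrow> point" where "SG_a n = (2 ^ n, 0)"
definition SG_b :: "nat \<Rightarrow> point" where "SG_b n = (0, 2 ^ n)"

definition translate :: "point \<Rightarrow> point \<Rightarrow> point" where
  "translate d p = (fst d + fst p, snd d + snd p)"

fun SG_verts :: "nat \<Rightarrow> point set" where
  "SG_verts 0 = {SG_o, SG_a 0, SG_b 0}"
| "SG_verts (Suc n) =
     SG_verts n \<union> translate (SG_a n) ` SG_verts n \<union> translate (SG_b n) ` SG_verts n"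

fun SG_edges :: "nat \<Rightarrow> point set set" where
  "SG_edges 0 = {{SG_o, SG_a 0}, {SG_o, SG_b 0}, {SG_a 0, SG_b 0}}"
| "SG_edges (Suc n) =
     SG_edges n \<union> (\<lambda>e. translate (SG_a n) ` e) ` SG_edges n
       \<union> (\<lambda>e. translate (SG_b n) ` e) ` SG_edges n"

lemma SG_corners: "SG_o \<in> SG_verts n" "SG_a n \<in> SG_verts n" "SG_b n \<in> SG_verts n"
proof -
  have "SG_o \<in> SG_verts n \<and> SG_a n \<in> SG_verts n \<and> SG_b n \<in> SG_verts n"
  proof (induction n)
    case 0
    show ?case by simp
  next
    case (Suc n)
    have "SG_a (Suc n) = translate (SG_a n) (SG_a n)" "SG_b (Suc n) = translate (SG_b n) (SG_b n)"
      by (simp_all add: SG_a_def SG_b_def translate_def)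
    with Suc show ?case by auto
  qed
  then show "SG_o \<in> SG_verts n" "SG_a n \<in> SG_verts n" "SG_b n \<in> SG_verts n" by auto
qed

lemma SG_verts_triangle: "p \<in> SG_verts n \<Longrightarrow> fst p + snd p \<le> 2 ^ n"
proof (induction n arbitrary: p)
  case 0
  then show ?case by (auto simp: SG_o_def SG_a_def SG_b_def)
next
  case (Suc n)
  from Suc.prems consider "p \<in> SG_verts n"
    | q where "q \<in> SG_verts n" "p = translate (SG_a n) q \<or> p = translate (SG_b n) q"
    by auto
  then show ?case
  proof cases
    case 1
    then show ?thesis using Suc.IH[OF 1] by simp
  next
    case 2
    then show ?thesis using Suc.IH[OF 2(1)] by (auto simp: translate_def SG_a_def SG_b_def)
  qed
qed

lemma SG_edges_wf: "e \<in> SG_edges n \<Longrightarrow> e \<subseteq> SG_verts n \<and> card e = 2"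
proof (induction n arbitrary: e)
  case 0
  then show ?case by (auto simp: SG_o_def SG_a_def SG_b_def)
next
  case (Suc n)
  have card: "card (translate d ` e') = card e'" for d e'
    by (rule card_image) (simp add: inj_on_def translate_def prod_eq_iff)
  from Suc.prems consider "e \<in> SG_edges n"
    | d e' where "d = SG_a n \<or> d = SG_b n" "e' \<in> SG_edges n" "e = translate d ` e'"
    unfolding SG_edges.simps by blast
  then show ?case
  proof cases
    case 1
    then show ?thesis using Suc.IH by auto
  next
    case 2
    then show ?thesis using Suc.IH[OF 2(2)] card by auto
  qed
qed

lemma SG_glue_left_right:
  "SG_verts n \<inter> translate (SG_a n) ` SG_verts n = {SG_a n}"
  "translate (SG_a n) SG_o = SG_a n"
proof -
  show eq: "translate (SG_a n) SG_o = SG_a n"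
    by (simp add: translate_def SG_o_def)
  have "p = SG_a n" if "p \<in> SG_verts n" "p \<in> translate (SG_a n) ` SG_verts n" for p
    using SG_verts_triangle[OF that(1)] that(2)
    by (auto simp: translate_def SG_a_def)
  then show "SG_verts n \<inter> translate (SG_a n) ` SG_verts n = {SG_a n}"
    using SG_corners(2)[of n] imageI[OF SG_corners(1), of "translate (SG_a n)" n] eq by auto
qed

lemma SG_glue_left_top:
  "SG_verts n \<inter> translate (SG_b n) ` SG_verts n = {SG_b n}"
  "translate (SG_b n) SG_o = SG_b n"
proof -
  show eq: "translate (SG_b n) SG_o = SG_b n"
    by (simp add: translate_def SG_o_def)
  have "p = SG_b n" if "p \<in> SG_verts n" "p \<in> translate (SG_b n) ` SG_verts n" for p
    using SG_verts_triangle[OF that(1)] that(2)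
    by (auto simp: translate_def SG_b_def)
  then show "SG_verts n \<inter> translate (SG_b n) ` SG_verts n = {SG_b n}"
    using SG_corners(3)[of n] imageI[OF SG_corners(1), of "translate (SG_b n)" n] eq by auto
qed

lemma SG_glue_right_top:
  "translate (SG_a n) ` SG_verts n \<inter> translate (SG_b n) ` SG_verts n
     = {translate (SG_a n) (SG_b n)}"
  "translate (SG_a n) (SG_b n) = translate (SG_b n) (SG_a n)"
proof -
  show eq: "translate (SG_a n) (SG_b n) = translate (SG_b n) (SG_a n)"
    by (simp add: translate_def SG_a_def SG_b_def)
  have uniq: "translate (SG_a n) p = translate (SG_a n) (SG_b n)"
    if "p \<in> SG_verts n" "q \<in> SG_verts n" "translate (SG_a n) p = translate (SG_b n) q" for p q
    using SG_verts_triangle[OF that(1)] SG_verts_triangle[OF that(2)] that(3)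
    by (auto simp: translate_def SG_a_def SG_b_def)
  show "translate (SG_a n) ` SG_verts n \<inter> translate (SG_b n) ` SG_verts n
      = {translate (SG_a n) (SG_b n)}" (is "?A \<inter> ?B = {?c}")
  proof (intro equalityI subsetI)
    fix r assume "r \<in> ?A \<inter> ?B"
    then obtain p q where "p \<in> SG_verts n" "q \<in> SG_verts n"
      "r = translate (SG_a n) p" "r = translate (SG_b n) q" by blast
    then show "r \<in> {?c}" using uniq by blast
  next
    fix r assume "r \<in> {?c}"
    moreover have "?c \<in> ?A" by (rule imageI) (rule SG_corners)
    moreover have "?c \<in> ?B" unfolding eq by (rule imageI) (rule SG_corners)
    ultimately show "r \<in> ?A \<inter> ?B" by blast
  qed
qed

section \<open>Counting spanning trees\<close>

definition SG_f :: "nat \<Rightarrow> nat" where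
  "SG_f n = card (spanning_trees (SG_verts n) (SG_edges n))"

definition SG_fdeg :: "nat \<Rightarrow> nat \<Rightarrow> point \<Rightarrow> nat" where
  "SG_fdeg j n x = card {T \<in> spanning_trees (SG_verts n) (SG_edges n). degree_in T x = j}"

definition SG_Fdeg :: "nat \<Rightarrow> nat \<Rightarrow> point \<Rightarrow> real" where
  "SG_Fdeg j n x = real (SG_fdeg j n x) / real (SG_f n)"

definition SG_alpha :: "nat \<Rightarrow> real" where
  "SG_alpha n = 1 / 2 * (3 ^ n - 1)"

definition SG_beta :: "nat \<Rightarrow> real" where
  "SG_beta n = 1 / 4 * (3 ^ (n + 1) + 2 * real n + 1)"

definition SG_gamma :: "nat \<Rightarrow> real" where
  "SG_gamma n = 1 / 4 * (3 ^ n - 2 * real n - 1)"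

end

(* The three corners of SG(n) are regarded as terminals. A forest in which every component
   contains a corner is classified by the partition that it induces on the corners; a spanning tree
   is the case of one block. Cutting SG(n + 1) into its three copies of SG(n) turns a forest of this
   kind into three forests of this kind, and the partition of the whole depends only on the three
   partitions. This gives a cubic recursion for the numbers of forests by partition. Edges at o lie
   in the lower-left copy only, so for a prescribed degree at o the recursion is linear in the
   refined numbers. Divided by the total numbers, which are f(n), f(n) q and 3 f(n) q^2 with
   q = (5/3)^n / 3 for one, two and three blocks, it has constant coefficients, and on the
   partitions in which o is not isolated its relevant eigenvalues are 1 and 1/15. *)

theory Submission
  imports Defs
begin

section \<open>Connectedness and spanning trees\<close>

text \<open>Connectedness is tested by two-colourings that are constant on edges, because colourings of
  the parts of a glued graph can simply be put together.\<close>

definition conn :: "'a set set \<Rightarrow> 'a \<Rightarrow> 'a \<Rightarrow> bool" where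
  "conn T x y \<longleftrightarrow> (\<forall>c :: 'a \<Rightarrow> bool. (\<forall>u v. {u, v} \<in> T \<longrightarrow> c u = c v) \<longrightarrow> c x = c y)"

text \<open>The set of vertices reachable from \<open>x\<close> is itself a colouring constant on
  edges. Conversely, such a colouring is constant along every path.\<close>

lemma conn_iff_rtrancl: "conn T x y \<longleftrightarrow> (x, y) \<in> {(x, y). {x, y} \<in> T}\<^sup>*" (is "_ \<longleftrightarrow> _ \<in> ?R\<^sup>*")
proof
  assume c: "conn T x y"
  have "sym ?R" by (auto simp: sym_def insert_commute)
  then have s: "sym (?R\<^sup>*)" by (rule sym_rtrancl)
  have "((x, u) \<in> ?R\<^sup>*) = ((x, v) \<in> ?R\<^sup>*)" if "{u, v} \<in> T" for u v
  proof -
    from that have "(u, v) \<in> ?R" "(v, u) \<in> ?R" by (auto simp: insert_commute)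
    then show ?thesis by (meson rtrancl.rtrancl_into_rtrancl)
  qed
  with c[unfolded conn_def, rule_format, of "\<lambda>z. (x, z) \<in> ?R\<^sup>*"]
  show "(x, y) \<in> ?R\<^sup>*" by blast
next
  assume "(x, y) \<in> ?R\<^sup>*"
  then show "conn T x y"
    by (induction rule: rtrancl_induct) (auto simp: conn_def)
qed

lemma conn_refl [simp]: "conn T x x"
  by (simp add: conn_def)

lemma conn_sym: "conn T x y \<longleftrightarrow> conn T y x"
  unfolding conn_def by metis

lemma conn_trans: "conn T x y \<Longrightarrow> conn T y z \<Longrightarrow> conn T x z"
  by (auto simp: conn_iff_rtrancl)

lemma conn_edge: "{x, y} \<in> T \<Longrightarrow> conn T x y"
  unfolding conn_def by blast

lemma conn_mono: "conn T x y \<Longrightarrow> T \<subseteq> U \<Longrightarrow> conn U x y"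
  unfolding conn_iff_rtrancl by (erule rtrancl_mono[THEN subsetD, rotated]) auto

definition edges_on :: "'a set \<Rightarrow> 'a set set \<Rightarrow> bool" where
  "edges_on V T \<longleftrightarrow> (\<forall>e\<in>T. e \<subseteq> V \<and> card e = 2)"

lemma edges_onD: "edges_on V T \<Longrightarrow> {x, y} \<in> T \<Longrightarrow> x \<in> V \<and> y \<in> V \<and> x \<noteq> y"
  unfolding edges_on_def by fastforce

lemma edges_on_finite: "edges_on V T \<Longrightarrow> finite V \<Longrightarrow> finite T"
  unfolding edges_on_def by (meson Pow_iff finite_Pow_iff finite_subset subsetI)

text \<open>Membership in \<open>V\<close> is a colouring constant on the edges of
  \<open>T\<close>.\<close>

lemma conn_in_verts:
  assumes "edges_on V T" "conn T x y" "x \<in> V"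
  shows "y \<in> V"
  using assms(2)[unfolded conn_def, rule_format, of "\<lambda>z. z \<in> V"] edges_onD[OF assms(1)] assms(3)
  by blast

lemma graph_connected_iff_conn:
  assumes "z \<in> V"
  shows "graph_connected V T \<longleftrightarrow> (\<forall>v\<in>V. conn T v z)"
  using assms unfolding graph_connected_def conn_iff_rtrancl[symmetric]
  by (meson conn_sym conn_trans empty_iff)

section \<open>Simple paths, cycles and search trees\<close>

text \<open>A simple path grows along a walk. When the walk returns to a vertex of the path, the
  path is cut there instead of being extended.\<close>

lemma simple_path_of_conn:
  assumes "conn T x y"
  obtains p where "p \<noteq> []" "distinct p" "hd p = x" "last p = y"
    "\<forall>i. Suc i < length p \<longrightarrow> {p ! i, p ! Suc i} \<in> T"
proof -
  from assms have "(x, y) \<in> {(x, y). {x, y} \<in> T}\<^sup>*" by (simp add: conn_iff_rtrancl)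
  then have "\<exists>p. p \<noteq> [] \<and> distinct p \<and> hd p = x \<and> last p = y \<and>
    (\<forall>i. Suc i < length p \<longrightarrow> {p ! i, p ! Suc i} \<in> T)"
  proof (induction rule: rtrancl_induct)
    case base
    show ?case by (rule exI[of _ "[x]"]) simp
  next
    case (step y z)
    then obtain p where p: "p \<noteq> []" "distinct p" "hd p = x" "last p = y"
      "\<forall>i. Suc i < length p \<longrightarrow> {p ! i, p ! Suc i} \<in> T" by blast
    show ?case
    proof (cases "z \<in> set p")
      case True
      then obtain k where k: "k < length p" "p ! k = z" by (auto simp: in_set_conv_nth)
      have "last (take (Suc k) p) = z" using k by (simp add: take_Suc_conv_app_nth)
      with p k show ?thesis by (intro exI[of _ "take (Suc k) p"]) auto
    next
      case False
      have "{(p @ [z]) ! i, (p @ [z]) ! Suc i} \<in> T" if "Suc i < length (p @ [z])" for i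
      proof (cases "Suc i < length p")
        case True
        then show ?thesis using p(5) by (simp add: nth_append)
      next
        case False
        with that have "Suc i = length p" by simp
        then have "(p @ [z]) ! i = y" "(p @ [z]) ! Suc i = z"
          using p(1,4) by (simp_all add: nth_append last_conv_nth flip: \<open>Suc i = length p\<close>)
        then show ?thesis using step by simp
      qed
      with False p show ?thesis by (intro exI[of _ "p @ [z]"]) auto
    qed
  qed
  then show ?thesis using that by blast
qed

text \<open>The edge closes a simple path in \<open>P\<close> between its ends. As it is not in
  \<open>P\<close>, the path is not that edge alone and so has at least three vertices.\<close>

lemma graph_cycle_of_extra_edge:
  assumes e: "{u, v} \<in> T - P" and "u \<noteq> v" and "P \<subseteq> T" and "conn P u v"
  shows "\<exists>p. graph_cycle T p"
proof -
  obtain p where p: "p \<noteq> []" "distinct p" "hd p = u" "last p = v"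
    "\<forall>i. Suc i < length p \<longrightarrow> {p ! i, p ! Suc i} \<in> P"
    using simple_path_of_conn[OF assms(4)] .
  have hl: "p ! 0 = u" "p ! (length p - 1) = v"
    using p by (simp_all add: hd_conv_nth last_conv_nth)
  have "length p \<noteq> 0" "length p \<noteq> 1" using p hl assms(2) by auto
  moreover have "length p \<noteq> 2"
  proof
    assume l: "length p = 2"
    then have "{p ! 0, p ! 1} \<in> P" using p(5)[rule_format, of 0] by simp
    then show False using e hl l by simp
  qed
  ultimately have l: "length p \<ge> 3" by linarith
  have "{p ! i, p ! (Suc i mod length p)} \<in> T" if "i < length p" for i
  proof (cases "Suc i = length p")
    case True
    then have "i = length p - 1" by simp
    then show ?thesis using True e hl by (simp add: insert_commute)
  next
    case False
    with that have "Suc i < length p" by simp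
    then show ?thesis using p(5) assms(3) by auto
  qed
  then show ?thesis using l p(2) unfolding graph_cycle_def by blast
qed

text \<open>\<open>d\<close> is the distance to the root \<open>z\<close>, and \<open>par v\<close>
  is the second vertex of a shortest path from \<open>v\<close> to \<open>z\<close>.\<close>

lemma conn_parents:
  assumes c: "\<forall>v\<in>V. conn T v z"
  obtains par :: "'a \<Rightarrow> 'a" and d :: "'a \<Rightarrow> nat"
  where "\<And>v. v \<in> V \<Longrightarrow> v \<noteq> z \<Longrightarrow> {v, par v} \<in> T \<and> d (par v) < d v"
proof -
  let ?R = "{(x, y). {x, y} \<in> T}"
  define d where "d v = (LEAST k. (v, z) \<in> ?R ^^ k)" for v
  have "\<exists>w. {v, w} \<in> T \<and> d w < d v" if "v \<in> V" "v \<noteq> z" for v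
  proof -
    have "(v, z) \<in> ?R\<^sup>*" using c that by (simp add: conn_iff_rtrancl)
    then have "\<exists>k. (v, z) \<in> ?R ^^ k" by (simp add: rtrancl_power)
    then have dv: "(v, z) \<in> ?R ^^ d v" unfolding d_def by (rule LeastI_ex)
    with that obtain k where k: "d v = Suc k" by (cases "d v") auto
    from dv[unfolded k] obtain w where w: "(v, w) \<in> ?R" "(w, z) \<in> ?R ^^ k"
      by (blast dest: relpow_Suc_D2)
    from w(2) have "d w \<le> k" unfolding d_def by (rule Least_le)
    with w k show ?thesis by auto
  qed
  then have "\<forall>v. \<exists>w. v \<in> V \<longrightarrow> v \<noteq> z \<longrightarrow> {v, w} \<in> T \<and> d w < d v" by blast
  then obtain par where "\<forall>v. v \<in> V \<longrightarrow> v \<noteq> z \<longrightarrow> {v, par v} \<in> T \<and> d (par v) < d v" by metis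
  then show ?thesis using that by blast
qed

text \<open>The parent edges of a search from the root. In a cycle of such edges a vertex of maximal
  depth would have the edge to its parent as both of its cycle edges.\<close>

lemma conn_subtree:
  assumes V: "finite V" and z: "z \<in> V" and T: "edges_on V T" and c: "\<forall>v\<in>V. conn T v z"
  obtains P where "P \<subseteq> T" "card P + 1 = card V" "\<forall>v\<in>V. conn P v z" "\<nexists>p. graph_cycle P p"
proof -
  obtain par d where pd: "\<And>v. v \<in> V \<Longrightarrow> v \<noteq> z \<Longrightarrow> {v, par v} \<in> T \<and> d (par v) < (d v :: nat)"
    using conn_parents[OF c] by metis
  define P where "P = (\<lambda>v. {v, par v}) ` (V - {z})"
  have sub: "P \<subseteq> T" using pd by (auto simp: P_def)
  have parV: "par v \<in> V" if "v \<in> V" "v \<noteq> z" for v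
    using pd[OF that] edges_onD[OF T] by blast
  \<comment> \<open>Two vertices with the same parent edge would be parents of each other, each less
    deep than the other.\<close>
  have "inj_on (\<lambda>v. {v, par v}) (V - {z})"
  proof (rule inj_onI)
    fix v w assume "v \<in> V - {z}" "w \<in> V - {z}" "{v, par v} = {w, par w}"
    with pd[of v] pd[of w] show "v = w" by (auto simp: doubleton_eq_iff)
  qed
  then have "card P = card (V - {z})" by (simp add: P_def card_image)
  with V z have card: "card P + 1 = card V"
    by (metis Suc_eq_plus1 card.remove)
  have con: "\<forall>v\<in>V. conn P v z"
  proof
    fix v assume "v \<in> V"
    then show "conn P v z"
    proof (induction "d v" arbitrary: v rule: less_induct)
      case less
      show ?case
      proof (cases "v = z")
        case False
        with less have "conn P (par v) z" using pd parV by blast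
        moreover have "conn P v (par v)"
          using less False by (intro conn_edge) (auto simp: P_def)
        ultimately show ?thesis using conn_trans by metis
      qed simp
    qed
  qed
  have "False" if cyc: "graph_cycle P p" for p
  proof -
    let ?n = "length p"
    from cyc have l: "?n \<ge> 3" "distinct p" and
      e: "\<And>i. i < ?n \<Longrightarrow> {p ! i, p ! (Suc i mod ?n)} \<in> P"
      by (auto simp: graph_cycle_def)
    obtain i where i: "i < ?n" "\<forall>k<?n. d (p ! k) \<le> d (p ! i)"
    proof -
      have "finite ((\<lambda>k. d (p ! k)) ` {..<?n})" "(\<lambda>k. d (p ! k)) ` {..<?n} \<noteq> {}"
        using l by (auto simp: lessThan_empty_iff)
      from Max_in[OF this] obtain i where "i < ?n" "Max ((\<lambda>k. d (p ! k)) ` {..<?n}) = d (p ! i)"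
        by auto
      then show ?thesis using that[of i] Max_ge[of "(\<lambda>k. d (p ! k)) ` {..<?n}"] by fastforce
    qed
    \<comment> \<open>The edge joins some \<open>x\<close> to \<open>par x\<close>. If
      \<open>p ! i\<close> were \<open>par x\<close>, then \<open>w = x\<close> would be deeper than
      \<open>p ! i\<close>, against maximality.\<close>
    have up: "w = par (p ! i)" if "{p ! i, w} \<in> P" "w \<in> set p" for w
    proof -
      from that(2) i have "d w \<le> d (p ! i)" by (auto simp: in_set_conv_nth)
      moreover from that(1) obtain x where "x \<in> V" "x \<noteq> z" "{p ! i, w} = {x, par x}"
        by (auto simp: P_def)
      ultimately show ?thesis using pd[of x] by (auto simp: doubleton_eq_iff)
    qed
    define s where "s = Suc i mod ?n"
    \<comment> \<open>The cyclic predecessor of \<open>i\<close>, as \<open>s\<close> is the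
      successor. The two differ because a cycle has at least three vertices, yet both would carry
      the parent of \<open>p ! i\<close>.\<close>
    define q where "q = (if i = 0 then ?n - 1 else i - 1)"
    have sq: "s < ?n" "q < ?n" "Suc q mod ?n = i" "s \<noteq> q"
      using i l by (auto simp: s_def q_def mod_Suc split: if_splits)
    have "p ! s = par (p ! i)" using up e[OF i(1)] sq by (simp add: s_def)
    moreover have "p ! q = par (p ! i)" using up e[OF sq(2)] sq by (simp add: insert_commute)
    ultimately show False using sq l by (metis nth_eq_iff_index_eq)
  qed
  with that sub card con show ?thesis by blast
qed

lemma card_verts_le:
  assumes "finite V" "z \<in> V" "edges_on V T" "\<forall>v\<in>V. conn T v z"
  shows "card V \<le> card T + 1"
  using conn_subtree[OF assms] card_mono[OF edges_on_finite[OF assms(3,1)]] by (metis add_le_mono1)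

text \<open>An edge outside the search tree \<open>P\<close> closes a cycle, so acyclicity means
  \<open>T = P\<close>, and so does the number of edges. Unlike acyclicity, this number simply adds
  up over glued parts.\<close>

lemma graph_tree_iff_card:
  assumes V: "finite V" and z: "z \<in> V" and T: "edges_on V T"
  shows "graph_tree V T \<longleftrightarrow> (\<forall>v\<in>V. conn T v z) \<and> card T + 1 = card V"
proof (cases "\<forall>v\<in>V. conn T v z")
  case True
  obtain P where P: "P \<subseteq> T" "card P + 1 = card V" "\<forall>v\<in>V. conn P v z" "\<nexists>p. graph_cycle P p"
    using conn_subtree[OF V z T True] .
  have "(\<nexists>p. graph_cycle T p) \<longleftrightarrow> card T + 1 = card V"
  proof
    assume "\<nexists>p. graph_cycle T p"
    have "T \<subseteq> P"
    proof
      fix e assume e: "e \<in> T"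
      with T obtain u v where uv: "e = {u, v}" "u \<noteq> v" "u \<in> V" "v \<in> V"
        unfolding edges_on_def by (metis card_2_iff insert_subset)
      have "conn P u v" using uv P(3) conn_trans conn_sym by metis
      then show "e \<in> P"
        using graph_cycle_of_extra_edge[of u v T P] e uv P(1) \<open>\<nexists>p. graph_cycle T p\<close> by blast
    qed
    with P show "card T + 1 = card V" by (metis subset_antisym)
  next
    assume "card T + 1 = card V"
    with P have "P = T"
      by (metis add_right_cancel card_subset_eq edges_on_finite[OF T V])
    with P show "\<nexists>p. graph_cycle T p" by simp
  qed
  with True show ?thesis
    by (simp add: graph_tree_def graph_connected_iff_conn[OF z])
next
  case False
  then show ?thesis by (auto simp: graph_tree_def graph_connected_iff_conn[OF z])
qed

section \<open>Partitions of the terminals\<close>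

text \<open>The partitions of three terminals 1, 2, 3; for example \<open>P2_13\<close> has the blocks {2} and {1, 3}.\<close>

datatype tpart = P123 | P1_23 | P2_13 | P3_12 | P1_2_3

definition join12 :: "tpart \<Rightarrow> bool" where "join12 \<pi> \<longleftrightarrow> \<pi> = P123 \<or> \<pi> = P3_12"
definition join13 :: "tpart \<Rightarrow> bool" where "join13 \<pi> \<longleftrightarrow> \<pi> = P123 \<or> \<pi> = P2_13"
definition join23 :: "tpart \<Rightarrow> bool" where "join23 \<pi> \<longleftrightarrow> \<pi> = P123 \<or> \<pi> = P1_23"

fun blocks :: "tpart \<Rightarrow> nat" where
  "blocks P123 = 1" | "blocks P1_23 = 2" | "blocks P2_13 = 2" | "blocks P3_12 = 2" | "blocks P1_2_3 = 3"

definition agrees :: "tpart \<Rightarrow> bool \<Rightarrow> bool \<Rightarrow> bool \<Rightarrow> bool" where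
  "agrees \<pi> x y z \<longleftrightarrow>
     (join12 \<pi> \<longrightarrow> x = y) \<and> (join13 \<pi> \<longrightarrow> x = z) \<and> (join23 \<pi> \<longrightarrow> y = z)"

text \<open>Six vertices: the outer corners x, y, z of a triangle and the midpoints c, d, m of its sides
  xy, xz, yz. The partitions l, r, t live on the corner triangles (x, c, d), (c, y, m), (d, m, z).
  With \<open>\<phi>\<close> an equation between two arguments, \<open>glued l r t \<phi>\<close> says that the join of the three
  partitions identifies these two vertices.\<close>

definition glued :: "tpart \<Rightarrow> tpart \<Rightarrow> tpart \<Rightarrow>
    (bool \<Rightarrow> bool \<Rightarrow> bool \<Rightarrow> bool \<Rightarrow> bool \<Rightarrow> bool \<Rightarrow> bool) \<Rightarrow> bool" where
  "glued l r t \<phi> \<longleftrightarrow>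
     (\<forall>x y z c d m. agrees l x c d \<and> agrees r c y m \<and> agrees t d m z \<longrightarrow> \<phi> x y z c d m)"

text \<open>The last three conjuncts put every midpoint into the block of an outer corner, so that
  no component is left without a terminal of the glued graph.\<close>

definition glues_to :: "tpart \<Rightarrow> tpart \<Rightarrow> tpart \<Rightarrow> tpart \<Rightarrow> bool" where
  "glues_to l r t \<pi> \<longleftrightarrow>
     glued l r t (\<lambda>x y z c d m. x = y) = join12 \<pi> \<and>
     glued l r t (\<lambda>x y z c d m. x = z) = join13 \<pi> \<and>
     glued l r t (\<lambda>x y z c d m. y = z) = join23 \<pi> \<and>
     (glued l r t (\<lambda>x y z c d m. c = x) \<or> glued l r t (\<lambda>x y z c d m. c = y) \<or>
       glued l r t (\<lambda>x y z c d m. c = z)) \<and>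
     (glued l r t (\<lambda>x y z c d m. d = x) \<or> glued l r t (\<lambda>x y z c d m. d = y) \<or>
       glued l r t (\<lambda>x y z c d m. d = z)) \<and>
     (glued l r t (\<lambda>x y z c d m. m = x) \<or> glued l r t (\<lambda>x y z c d m. m = y) \<or>
       glued l r t (\<lambda>x y z c d m. m = z))"

text \<open>The equation for the numbers of blocks says that gluing closes no cycle.\<close>

definition glue_table :: "tpart \<Rightarrow> (tpart \<times> tpart \<times> tpart) set" where
  "glue_table \<pi> = {(l, r, t). glues_to l r t \<pi> \<and> blocks l + blocks r + blocks t = blocks \<pi> + 3}"

text \<open>The three corner triangles form a ring, so two vertices can be linked along two routes
  only, one for each sense of rotation. Each disjunct is one of them.\<close>

lemma glued_iff:
  "glued l r t (\<lambda>x y z c d m. x = y) \<longleftrightarrow> join12 l \<and> join12 r \<or> join13 l \<and> join12 t \<and> join23 r"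
  "glued l r t (\<lambda>x y z c d m. x = z) \<longleftrightarrow> join13 l \<and> join13 t \<or> join12 l \<and> join13 r \<and> join23 t"
  "glued l r t (\<lambda>x y z c d m. c = x) \<longleftrightarrow> join12 l \<or> join13 l \<and> join12 t \<and> join13 r"
  "glued l r t (\<lambda>x y z c d m. d = x) \<longleftrightarrow> join13 l \<or> join12 l \<and> join13 r \<and> join12 t"
  "glued l r t (\<lambda>x y z c d m. m = x) \<longleftrightarrow> join12 l \<and> join13 r \<or> join13 l \<and> join12 t"
  "glued l r t (\<lambda>x y z c d m. y = z) \<longleftrightarrow> join23 r \<and> join23 t \<or> join12 r \<and> join23 l \<and> join13 t"
  "glued l r t (\<lambda>x y z c d m. c = y) \<longleftrightarrow> join12 r \<or> join23 r \<and> join12 t \<and> join23 l"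
  "glued l r t (\<lambda>x y z c d m. d = y) \<longleftrightarrow> join12 r \<and> join23 l \<or> join23 r \<and> join12 t"
  "glued l r t (\<lambda>x y z c d m. m = y) \<longleftrightarrow> join23 r \<or> join12 r \<and> join23 l \<and> join12 t"
  "glued l r t (\<lambda>x y z c d m. c = z) \<longleftrightarrow> join13 t \<and> join23 l \<or> join23 t \<and> join13 r"
  "glued l r t (\<lambda>x y z c d m. d = z) \<longleftrightarrow> join13 t \<or> join23 t \<and> join13 r \<and> join23 l"
  "glued l r t (\<lambda>x y z c d m. m = z) \<longleftrightarrow> join23 t \<or> join13 t \<and> join23 l \<and> join13 r"
  unfolding glued_def agrees_def join12_def join13_def join23_def
  by (cases l; cases r; cases t; simp add: all_bool_eq)+

text \<open>Each of the three identifications at the midpoints lowers the number of blocks by at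
  most one, and by \<open>glues_to\<close> the blocks that remain are those of
  \<open>\<pi>\<close>.\<close>

lemma blocks_glued: "glues_to l r t \<pi> \<Longrightarrow> blocks l + blocks r + blocks t \<le> blocks \<pi> + 3"
  unfolding glues_to_def glued_iff join12_def join13_def join23_def
  by (cases l; cases r; cases t; cases \<pi>; simp)

lemma triple_set_eqI: "(\<And>x y z. (x, y, z) \<in> X \<longleftrightarrow> (x, y, z) \<in> Y) \<Longrightarrow> X = Y"
  by auto

lemma glue_table:
  "glue_table P123 =
     {(P123, P123, P1_23), (P123, P123, P2_13), (P123, P1_23, P123), (P123, P3_12, P123),
      (P2_13, P123, P123), (P3_12, P123, P123)}"
  "glue_table P1_23 =
     {(P123, P1_23, P1_23), (P1_23, P123, P1_23), (P1_23, P123, P2_13), (P1_23, P1_23, P123),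
      (P1_23, P3_12, P123), (P2_13, P123, P1_23), (P3_12, P1_23, P123), (P1_2_3, P123, P123)}"
  "glue_table P2_13 =
     {(P123, P1_23, P2_13), (P123, P2_13, P1_23), (P123, P2_13, P2_13), (P123, P1_2_3, P123),
      (P2_13, P123, P2_13), (P2_13, P2_13, P123), (P2_13, P3_12, P123), (P3_12, P2_13, P123)}"
  "glue_table P3_12 =
     {(P123, P123, P1_2_3), (P123, P1_23, P3_12), (P123, P3_12, P1_23), (P123, P3_12, P3_12),
      (P2_13, P123, P3_12), (P3_12, P123, P2_13), (P3_12, P123, P3_12), (P3_12, P3_12, P123)}"
  "glue_table P1_2_3 =
     {(P123, P1_23, P1_2_3), (P123, P2_13, P1_2_3), (P123, P1_2_3, P1_23), (P123, P1_2_3, P3_12),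
      (P1_23, P123, P1_2_3), (P1_23, P1_23, P2_13), (P1_23, P1_23, P3_12), (P1_23, P2_13, P1_23),
      (P1_23, P2_13, P2_13), (P1_23, P3_12, P1_23), (P1_23, P3_12, P3_12), (P1_23, P1_2_3, P123),
      (P2_13, P123, P1_2_3), (P2_13, P2_13, P1_23), (P2_13, P2_13, P3_12), (P2_13, P3_12, P1_23),
      (P2_13, P3_12, P3_12), (P3_12, P1_23, P2_13), (P3_12, P1_23, P3_12), (P3_12, P2_13, P2_13),
      (P3_12, P2_13, P3_12), (P3_12, P1_2_3, P123), (P1_2_3, P123, P2_13), (P1_2_3, P123, P3_12),
      (P1_2_3, P2_13, P123), (P1_2_3, P3_12, P123)}"
  unfolding glue_table_def glues_to_def glued_iff join12_def join13_def join23_def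
  by (rule triple_set_eqI, unfold mem_Collect_eq prod.case, case_tac x; case_tac y; case_tac z; simp)+

section \<open>Gluing three graphs in a triangle\<close>

definition induces :: "'a set set \<Rightarrow> 'a \<Rightarrow> 'a \<Rightarrow> 'a \<Rightarrow> tpart \<Rightarrow> bool" where
  "induces T p q r \<pi> \<longleftrightarrow>
     conn T p q = join12 \<pi> \<and> conn T p r = join13 \<pi> \<and> conn T q r = join23 \<pi>"

lemma induces_ex: "\<exists>\<pi>. induces T p q r \<pi>"
proof -
  have "conn T p q \<Longrightarrow> conn T p r \<Longrightarrow> conn T q r" "conn T p q \<Longrightarrow> conn T q r \<Longrightarrow> conn T p r"
    "conn T p r \<Longrightarrow> conn T q r \<Longrightarrow> conn T p q"
    using conn_trans conn_sym by metis+
  then have "induces T p q r (if conn T p q then if conn T p r then P123 else P3_12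
      else if conn T p r then P2_13 else if conn T q r then P1_23 else P1_2_3)"
    unfolding induces_def join12_def join13_def join23_def by (simp; blast)
  then show ?thesis by blast
qed

lemma induces_unique: "induces T p q r \<pi> \<Longrightarrow> induces T p q r \<rho> \<Longrightarrow> \<pi> = \<rho>"
  unfolding induces_def join12_def join13_def join23_def by (cases \<pi>; cases \<rho>; simp)

definition covered :: "'a set \<Rightarrow> 'a set set \<Rightarrow> 'a \<Rightarrow> 'a \<Rightarrow> 'a \<Rightarrow> bool" where
  "covered V T p q r \<longleftrightarrow> (\<forall>v\<in>V. conn T v p \<or> conn T v q \<or> conn T v r)"

text \<open>Acyclicity is encoded by the number of edges, which is the least possible one by
  \<open>card_verts_le_blocks\<close> below.\<close>

definition terminal_forest :: "'a set \<Rightarrow> 'a \<Rightarrow> 'a \<Rightarrow> 'a \<Rightarrow> tpart \<Rightarrow> 'a set set \<Rightarrow> bool" where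
  "terminal_forest V p q r \<pi> T \<longleftrightarrow>
     covered V T p q r \<and> induces T p q r \<pi> \<and> card T + blocks \<pi> = card V"

text \<open>At most \<open>blocks \<pi> - 1\<close> edges between terminals make the graph
  connected, and a connected graph on \<open>V\<close> has at least \<open>card V - 1\<close>
  edges.\<close>

lemma card_verts_le_blocks:
  assumes V: "finite V" "p \<in> V" "q \<in> V" "r \<in> V" and pqr: "distinct [p, q, r]"
    and T: "edges_on V T" and cov: "covered V T p q r" and ind: "induces T p q r \<pi>"
  shows "card V \<le> card T + blocks \<pi>"
proof -
  \<comment> \<open>edges that join the blocks to a connected graph\<close>
  define X where "X = (if join12 \<pi> then {} else {{p, q}}) \<union>
    (if join13 \<pi> \<or> join23 \<pi> then {} else {{p, r}})"
  have eX: "edges_on V (T \<union> X)"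
    using T V pqr by (auto simp: edges_on_def X_def split: if_splits)
  have q: "conn (T \<union> X) q p"
  proof (cases "join12 \<pi>")
    case True
    then have "conn T q p" using ind conn_sym unfolding induces_def by metis
    then show ?thesis by (rule conn_mono) simp
  next
    case False
    then show ?thesis by (intro conn_edge) (simp add: X_def insert_commute)
  qed
  have r: "conn (T \<union> X) r p"
  proof (cases "join13 \<pi> \<or> join23 \<pi>")
    case True
    then have "conn T r p \<or> conn T r q" using ind conn_sym unfolding induces_def by metis
    then have "conn (T \<union> X) r p \<or> conn (T \<union> X) r q" by (meson conn_mono Un_upper1)
    then show ?thesis using q conn_trans by metis
  next
    case False
    then show ?thesis by (intro conn_edge) (simp add: X_def insert_commute)
  qed
  have "conn (T \<union> X) v p" if "v \<in> V" for v
  proof -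
    have "conn T v p \<or> conn T v q \<or> conn T v r" using cov that by (simp add: covered_def)
    then have "conn (T \<union> X) v p \<or> conn (T \<union> X) v q \<or> conn (T \<union> X) v r"
      by (meson conn_mono Un_upper1)
    then show ?thesis using q r conn_trans by metis
  qed
  then have "card V \<le> card (T \<union> X) + 1"
    using card_verts_le[OF V(1,2) eX] by blast
  moreover have "card (T \<union> X) \<le> card T + card X" by (rule card_Un_le)
  moreover have "card X + 1 \<le> blocks \<pi>"
    by (cases \<pi>) (auto simp: X_def join12_def join13_def join23_def card_insert_if)
  ultimately show ?thesis by linarith
qed

lemma graph_tree_iff_terminal_forest:
  assumes V: "finite V" "p \<in> V" "q \<in> V" "r \<in> V" and T: "edges_on V T"
  shows "graph_tree V T \<longleftrightarrow> terminal_forest V p q r P123 T"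
proof -
  have "(\<forall>v\<in>V. conn T v p) \<longleftrightarrow> covered V T p q r \<and> induces T p q r P123"
    unfolding covered_def induces_def join12_def join13_def join23_def
    using V conn_trans conn_sym by (metis (full_types))
  then show ?thesis
    unfolding graph_tree_iff_card[OF V(1,2) T] terminal_forest_def by auto
qed

text \<open>Colourings are transported by composition with \<open>f\<close> in one direction and
  with \<open>inv f\<close> in the other.\<close>

lemma conn_image:
  assumes "inj f"
  shows "conn ((`) f ` T) (f x) (f y) \<longleftrightarrow> conn T x y"
proof
  assume c: "conn ((`) f ` T) (f x) (f y)"
  show "conn T x y" unfolding conn_def
  proof (intro allI impI)
    fix g :: "'a \<Rightarrow> bool" assume g: "\<forall>u v. {u, v} \<in> T \<longrightarrow> g u = g v"
    have "g (inv f u) = g (inv f v)" if "{u, v} \<in> (`) f ` T" for u v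
    proof -
      from that obtain e where e: "e \<in> T" "{u, v} = f ` e" by blast
      then have "inv f ` {u, v} = e" by (simp add: image_inv_f_f[OF assms])
      then show ?thesis using g e(1) by simp
    qed
    then have "g (inv f (f x)) = g (inv f (f y))"
      using c[unfolded conn_def, rule_format, of "g \<circ> inv f"] by simp
    then show "g x = g y" using assms by simp
  qed
next
  assume c: "conn T x y"
  show "conn ((`) f ` T) (f x) (f y)" unfolding conn_def
  proof (intro allI impI)
    fix g :: "'b \<Rightarrow> bool" assume g: "\<forall>u v. {u, v} \<in> (`) f ` T \<longrightarrow> g u = g v"
    have "g (f u) = g (f v)" if "{u, v} \<in> T" for u v
      using g[rule_format, of "f u" "f v"] imageI[OF that, of "(`) f"] by simp
    then show "g (f x) = g (f y)"
      using c[unfolded conn_def, rule_format, of "g \<circ> f"] by simp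
  qed
qed

lemma terminal_forest_image:
  assumes "inj f"
  shows "terminal_forest (f ` V) (f p) (f q) (f r) \<pi> ((`) f ` T) \<longleftrightarrow> terminal_forest V p q r \<pi> T"
proof -
  have "card ((`) f ` T) = card T" "card (f ` V) = card V"
    by (auto intro!: card_image inj_onI simp: inj_image_eq_iff[OF assms] inj_eq[OF assms])
  then show ?thesis
    by (simp add: terminal_forest_def covered_def induces_def conn_image[OF assms])
qed

text \<open>Extends a colouring of the terminals to all vertices along T.\<close>

definition spread :: "'a set set \<Rightarrow> 'a \<Rightarrow> 'a \<Rightarrow> 'a \<Rightarrow> bool \<Rightarrow> bool \<Rightarrow> bool \<Rightarrow> 'a \<Rightarrow> bool" where
  "spread T p q r x y z v =
     (if conn T v p then x else if conn T v q then y else if conn T v r then z else False)"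

lemma spread_edge:
  assumes "{u, v} \<in> T"
  shows "spread T p q r x y z u = spread T p q r x y z v"
proof -
  have "conn T u w = conn T v w" for w
    using conn_edge[OF assms] conn_sym conn_trans by metis
  then show ?thesis by (simp add: spread_def)
qed

lemma spread_terminals:
  assumes "induces T p q r \<pi>" "agrees \<pi> x y z"
  shows "spread T p q r x y z p = x" "spread T p q r x y z q = y" "spread T p q r x y z r = z"
  using assms conn_sym[of T q p] conn_sym[of T r p] conn_sym[of T r q]
  by (auto simp: spread_def induces_def agrees_def)

text \<open>A component of \<open>T\<close> that avoids the separator \<open>S\<close> has no vertex
  in \<open>V'\<close>, so no edge of \<open>T'\<close> can enlarge it: being connected to
  \<open>v\<close> in \<open>T\<close> is a colouring constant on all edges.\<close>

lemma conn_within_part: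
  assumes "edges_on V T" "edges_on V' T'" "V \<inter> V' \<subseteq> S" "v \<in> V"
    and S: "\<forall>s\<in>S. \<not> conn T v s" and c: "conn (T \<union> T') v x"
  shows "conn T v x"
proof -
  have "conn T v y = conn T v z" if "{y, z} \<in> T \<union> T'" for y z
  proof (cases "{y, z} \<in> T")
    case True
    then show ?thesis using conn_edge conn_sym conn_trans by metis
  next
    case False
    then have "y \<in> V'" "z \<in> V'" using that edges_onD[OF assms(2)] by blast+
    then show ?thesis using conn_in_verts[OF assms(1)] assms(3,4) S by blast
  qed
  then have "conn T v v = conn T v x" using c[unfolded conn_def, rule_format, of "conn T v"] by blast
  then show ?thesis by simp
qed

text \<open>The parts have the terminals (w, c, d), (c, a, m) and (d, m, b). The outer corners w, a,
  b and the midpoints c, d, m take the roles of x, y, z, c, d, m in \<open>glued\<close>.\<close>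

locale triangle_gluing =
  fixes V1 V2 V3 :: "'a set" and w a b c d m :: 'a
  assumes fin: "finite V1" "finite V2" "finite V3"
    and mids: "V1 \<inter> V2 = {c}" "V1 \<inter> V3 = {d}" "V2 \<inter> V3 = {m}"
    and outer: "w \<in> V1" "a \<in> V2" "b \<in> V3"
    and dist: "distinct [w, a, b, c, d, m]"
begin

lemma terminals_in: "c \<in> V1" "c \<in> V2" "d \<in> V1" "d \<in> V3" "m \<in> V2" "m \<in> V3"
  using mids by auto

lemma terminals_notin: "w \<notin> V2" "w \<notin> V3" "a \<notin> V1" "a \<notin> V3" "b \<notin> V1" "b \<notin> V2"
    "c \<notin> V3" "d \<notin> V2" "m \<notin> V1"
proof -
  have eq: "x \<in> V1 \<Longrightarrow> x \<in> V2 \<Longrightarrow> x = c" "x \<in> V1 \<Longrightarrow> x \<in> V3 \<Longrightarrow> x = d"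
    "x \<in> V2 \<Longrightarrow> x \<in> V3 \<Longrightarrow> x = m" for x
    using mids by blast+
  moreover have "w \<noteq> c" "w \<noteq> d" "a \<noteq> c" "a \<noteq> m" "b \<noteq> d" "b \<noteq> m" "c \<noteq> d" "c \<noteq> m" "d \<noteq> m"
    using dist by auto
  ultimately show "w \<notin> V2" "w \<notin> V3" "a \<notin> V1" "a \<notin> V3" "b \<notin> V1" "b \<notin> V2"
      "c \<notin> V3" "d \<notin> V2" "m \<notin> V1"
    using outer terminals_in by metis+
qed

lemma card_verts: "card (V1 \<union> V2 \<union> V3) + 3 = card V1 + card V2 + card V3"
proof -
  have "(V1 \<union> V2) \<inter> V3 = {d, m}" using mids by auto
  then have "card (V1 \<union> V2) + card V3 = card (V1 \<union> V2 \<union> V3) + 2"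
    using card_Un_Int[of "V1 \<union> V2" V3] fin dist by simp
  moreover have "card V1 + card V2 = card (V1 \<union> V2) + 1"
    using card_Un_Int[of V1 V2] fin mids by simp
  ultimately show ?thesis by simp
qed

text \<open>An edge has two vertices, but two parts share only one.\<close>

lemma edges_disjoint:
  assumes "edges_on V1 T1" "edges_on V2 T2" "edges_on V3 T3"
  shows "T1 \<inter> T2 = {}" "T1 \<inter> T3 = {}" "T2 \<inter> T3 = {}"
proof -
  have *: "X \<inter> Y = {}" if "edges_on V X" "edges_on U Y" "V \<inter> U = {z}" for V U z and X Y :: "'a set set"
  proof (rule ccontr)
    assume "X \<inter> Y \<noteq> {}"
    then obtain e where "e \<in> X" "e \<in> Y" by blast
    then have "e \<subseteq> V \<inter> U" "card e = 2" using that(1,2) by (simp_all add: edges_on_def)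
    then have "e \<subseteq> {z}" "card e = 2" unfolding that(3) .
    then show False using card_mono[of "{z}" e] by simp
  qed
  show "T1 \<inter> T2 = {}" "T1 \<inter> T3 = {}" "T2 \<inter> T3 = {}"
    using *[OF assms(1,2) mids(1)] *[OF assms(1,3) mids(2)] *[OF assms(2,3) mids(3)] .
qed

context
  fixes T1 T2 T3 :: "'a set set"
  assumes T: "edges_on V1 T1" "edges_on V2 T2" "edges_on V3 T3"
begin

lemma card_edges: "card (T1 \<union> T2 \<union> T3) = card T1 + card T2 + card T3"
proof -
  have "finite T1" "finite T2" "finite T3" using T fin edges_on_finite by blast+
  moreover have "(T1 \<union> T2) \<inter> T3 = {}" using edges_disjoint[OF T] by blast
  ultimately show ?thesis using edges_disjoint[OF T] by (simp add: card_Un_disjoint)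
qed

text \<open>A colouring constant on the edges of the union restricts to one on each part.
  Conversely, colours of the six terminals that respect the three partitions spread over the parts
  and fit together at the midpoints. An arbitrary \<open>\<phi>\<close> handles all pairs of
  terminals at once.\<close>

lemma colourings_glued:
  assumes ind: "induces T1 w c d l" "induces T2 c a m r" "induces T3 d m b t"
  shows "(\<forall>k :: 'a \<Rightarrow> bool. (\<forall>u v. {u, v} \<in> T1 \<union> T2 \<union> T3 \<longrightarrow> k u = k v) \<longrightarrow>
      \<phi> (k w) (k a) (k b) (k c) (k d) (k m)) \<longleftrightarrow> glued l r t \<phi>"
proof
  assume g: "glued l r t \<phi>"
  show "\<forall>k :: 'a \<Rightarrow> bool. (\<forall>u v. {u, v} \<in> T1 \<union> T2 \<union> T3 \<longrightarrow> k u = k v) \<longrightarrow>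
      \<phi> (k w) (k a) (k b) (k c) (k d) (k m)"
  proof (intro allI impI)
    fix k :: "'a \<Rightarrow> bool" assume k: "\<forall>u v. {u, v} \<in> T1 \<union> T2 \<union> T3 \<longrightarrow> k u = k v"
    have "k x = k y" if "conn T1 x y \<or> conn T2 x y \<or> conn T3 x y" for x y
      using that k unfolding conn_def by blast
    then have "agrees l (k w) (k c) (k d)" "agrees r (k c) (k a) (k m)" "agrees t (k d) (k m) (k b)"
      using ind unfolding agrees_def induces_def by blast+
    with g show "\<phi> (k w) (k a) (k b) (k c) (k d) (k m)" unfolding glued_def by blast
  qed
next
  assume k: "\<forall>k :: 'a \<Rightarrow> bool. (\<forall>u v. {u, v} \<in> T1 \<union> T2 \<union> T3 \<longrightarrow> k u = k v) \<longrightarrow>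
      \<phi> (k w) (k a) (k b) (k c) (k d) (k m)"
  show "glued l r t \<phi>" unfolding glued_def
  proof (intro allI impI)
    fix ko ka kb kc kd km
    assume "agrees l ko kc kd \<and> agrees r kc ka km \<and> agrees t kd km kb"
    then have ag: "agrees l ko kc kd" "agrees r kc ka km" "agrees t kd km kb" by auto
    let ?k1 = "spread T1 w c d ko kc kd" and ?k2 = "spread T2 c a m kc ka km"
      and ?k3 = "spread T3 d m b kd km kb"
    note sp = spread_terminals[OF ind(1) ag(1)] spread_terminals[OF ind(2) ag(2)]
      spread_terminals[OF ind(3) ag(3)]
    \<comment> \<open>A shared vertex takes its colour from the first part that contains it. The
      facts \<open>k2\<close> and \<open>k3\<close> show that the order does not matter, as the
      spread colourings agree at the midpoints.\<close>
    define k where "k v = (if v \<in> V1 then ?k1 v else if v \<in> V2 then ?k2 v else ?k3 v)" for v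
    have k1: "k v = ?k1 v" if "v \<in> V1" for v using that by (simp add: k_def)
    have k2: "k v = ?k2 v" if "v \<in> V2" for v
    proof (cases "v \<in> V1")
      case True
      then have "v = c" using that mids by blast
      then show ?thesis using sp True by (simp add: k_def)
    qed (simp add: k_def that)
    have k3: "k v = ?k3 v" if "v \<in> V3" for v
    proof (cases "v \<in> V1 \<or> v \<in> V2")
      case True
      then have "v = d \<or> v = m" using that mids by blast
      then show ?thesis using sp terminals_in terminals_notin by (auto simp: k_def)
    qed (simp add: k_def that)
    have "k u = k v" if "{u, v} \<in> T1 \<union> T2 \<union> T3" for u v
    proof -
      from that consider "{u, v} \<in> T1" | "{u, v} \<in> T2" | "{u, v} \<in> T3" by blast
      then show ?thesis
      proof cases
        case 1
        then show ?thesis using edges_onD[OF T(1)] k1 spread_edge[OF 1] by metis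
      next
        case 2
        then show ?thesis using edges_onD[OF T(2)] k2 spread_edge[OF 2] by metis
      next
        case 3
        then show ?thesis using edges_onD[OF T(3)] k3 spread_edge[OF 3] by metis
      qed
    qed
    then have "\<phi> (k w) (k a) (k b) (k c) (k d) (k m)" using k by blast
    moreover have "k w = ko" "k a = ka" "k b = kb" "k c = kc" "k d = kd" "k m = km"
      using sp k1 k2 k3 outer terminals_in by auto
    ultimately show "\<phi> ko ka kb kc kd km" by simp
  qed
qed

lemma conn_glued:
  assumes ind: "induces T1 w c d l" "induces T2 c a m r" "induces T3 d m b t"
  defines "U \<equiv> T1 \<union> T2 \<union> T3"
  shows "conn U w a \<longleftrightarrow> glued l r t (\<lambda>x y z c d m. x = y)"
    "conn U w b \<longleftrightarrow> glued l r t (\<lambda>x y z c d m. x = z)"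
    "conn U a b \<longleftrightarrow> glued l r t (\<lambda>x y z c d m. y = z)"
    "conn U c w \<longleftrightarrow> glued l r t (\<lambda>x y z c d m. c = x)"
    "conn U c a \<longleftrightarrow> glued l r t (\<lambda>x y z c d m. c = y)"
    "conn U c b \<longleftrightarrow> glued l r t (\<lambda>x y z c d m. c = z)"
    "conn U d w \<longleftrightarrow> glued l r t (\<lambda>x y z c d m. d = x)"
    "conn U d a \<longleftrightarrow> glued l r t (\<lambda>x y z c d m. d = y)"
    "conn U d b \<longleftrightarrow> glued l r t (\<lambda>x y z c d m. d = z)"
    "conn U m w \<longleftrightarrow> glued l r t (\<lambda>x y z c d m. m = x)"
    "conn U m a \<longleftrightarrow> glued l r t (\<lambda>x y z c d m. m = y)"
    "conn U m b \<longleftrightarrow> glued l r t (\<lambda>x y z c d m. m = z)"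
  unfolding conn_def U_def colourings_glued[OF ind, symmetric] by (rule refl)+

text \<open>A component of one part that misses all terminals of this part stays a component of the
  union and contains no outer corner. Conversely, every vertex is linked to a terminal of its part,
  and each midpoint to an outer corner.\<close>

lemma covered_glued:
  defines "U \<equiv> T1 \<union> T2 \<union> T3"
  shows "covered (V1 \<union> V2 \<union> V3) U w a b \<longleftrightarrow>
     covered V1 T1 w c d \<and> covered V2 T2 c a m \<and> covered V3 T3 d m b \<and> covered {c, d, m} U w a b"
    (is "?L \<longleftrightarrow> ?R")
proof
  assume L: ?L
  have "conn T1 v w \<or> conn T1 v c \<or> conn T1 v d" if v: "v \<in> V1" for v
  proof (rule ccontr)
    assume n: "\<not> ?thesis"
    have "conn T1 v x" if "conn U v x" for x
    proof (rule conn_within_part[OF T(1) _ _ v])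
      show "edges_on (V2 \<union> V3) (T2 \<union> T3)" using T by (auto simp: edges_on_def)
      show "V1 \<inter> (V2 \<union> V3) \<subseteq> {c, d}" using mids by blast
      show "conn (T1 \<union> (T2 \<union> T3)) v x" using that by (simp add: U_def Un_assoc)
    qed (use n in simp)
    then have "conn T1 v a \<or> conn T1 v b" using L v n unfolding covered_def by blast
    then show False using conn_in_verts[OF T(1) _ v] terminals_notin by blast
  qed
  moreover have "conn T2 v c \<or> conn T2 v a \<or> conn T2 v m" if v: "v \<in> V2" for v
  proof (rule ccontr)
    assume n: "\<not> ?thesis"
    have "conn T2 v x" if "conn U v x" for x
    proof (rule conn_within_part[OF T(2) _ _ v])
      show "edges_on (V1 \<union> V3) (T1 \<union> T3)" using T by (auto simp: edges_on_def)
      show "V2 \<inter> (V1 \<union> V3) \<subseteq> {c, m}" using mids by blast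
      show "conn (T2 \<union> (T1 \<union> T3)) v x" using that by (simp add: U_def Un_ac)
    qed (use n in simp)
    then have "conn T2 v w \<or> conn T2 v b" using L v n unfolding covered_def by blast
    then show False using conn_in_verts[OF T(2) _ v] terminals_notin by blast
  qed
  moreover have "conn T3 v d \<or> conn T3 v m \<or> conn T3 v b" if v: "v \<in> V3" for v
  proof (rule ccontr)
    assume n: "\<not> ?thesis"
    have "conn T3 v x" if "conn U v x" for x
    proof (rule conn_within_part[OF T(3) _ _ v])
      show "edges_on (V1 \<union> V2) (T1 \<union> T2)" using T by (auto simp: edges_on_def)
      show "V3 \<inter> (V1 \<union> V2) \<subseteq> {d, m}" using mids by blast
      show "conn (T3 \<union> (T1 \<union> T2)) v x" using that by (simp add: U_def Un_ac)
    qed (use n in simp)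
    then have "conn T3 v w \<or> conn T3 v a" using L v n unfolding covered_def by blast
    then show False using conn_in_verts[OF T(3) _ v] terminals_notin by blast
  qed
  ultimately show ?R using L terminals_in unfolding covered_def by blast
next
  assume R: ?R
  have "conn U v w \<or> conn U v a \<or> conn U v b" if "v \<in> V1 \<union> V2 \<union> V3" for v
  proof -
    have up: "conn U v x" if "conn T1 v x \<or> conn T2 v x \<or> conn T3 v x" for x
      using that unfolding U_def conn_def by blast
    have "conn U v w \<or> conn U v a \<or> conn U v b \<or> conn U v c \<or> conn U v d \<or> conn U v m"
      using that R up unfolding covered_def by blast
    moreover have "conn U x w \<or> conn U x a \<or> conn U x b" if "x \<in> {c, d, m}" for x
      using R that unfolding covered_def by blast
    ultimately show ?thesis using conn_trans[of U v] by blast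
  qed
  then show ?L unfolding covered_def by blast
qed

theorem terminal_forest_glued:
  "terminal_forest (V1 \<union> V2 \<union> V3) w a b \<pi> (T1 \<union> T2 \<union> T3) \<longleftrightarrow>
     (\<exists>(l, r, t) \<in> glue_table \<pi>. terminal_forest V1 w c d l T1 \<and>
        terminal_forest V2 c a m r T2 \<and> terminal_forest V3 d m b t T3)"
    (is "?L \<longleftrightarrow> ?R")
proof -
  let ?V = "V1 \<union> V2 \<union> V3" and ?U = "T1 \<union> T2 \<union> T3"
  obtain l r t where ind: "induces T1 w c d l" "induces T2 c a m r" "induces T3 d m b t"
    using induces_ex by metis
  let ?C = "covered V1 T1 w c d \<and> covered V2 T2 c a m \<and> covered V3 T3 d m b"
  have cov: "covered ?V ?U w a b \<and> induces ?U w a b \<pi> \<longleftrightarrow> ?C \<and> glues_to l r t \<pi>"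
    unfolding covered_glued
    by (simp add: covered_def[of "{c, d, m}"] induces_def[of ?U] glues_to_def conn_glued[OF ind] conj_ac)
  have le: "card V1 \<le> card T1 + blocks l" "card V2 \<le> card T2 + blocks r"
    "card V3 \<le> card T3 + blocks t" if ?C
    using that fin outer terminals_in dist T ind
    by (auto intro!: card_verts_le_blocks[of V1 w c d] card_verts_le_blocks[of V2 c a m]
        card_verts_le_blocks[of V3 d m b])
  have "?L \<longleftrightarrow> ?C \<and> glues_to l r t \<pi> \<and> card ?U + blocks \<pi> = card ?V"
    unfolding terminal_forest_def using cov by blast
  also have "\<dots> \<longleftrightarrow> ?C \<and> (l, r, t) \<in> glue_table \<pi> \<and> card T1 + blocks l = card V1 \<and>
      card T2 + blocks r = card V2 \<and> card T3 + blocks t = card V3"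
    \<comment> \<open>Summing \<open>le\<close> gives
      \<open>card ?V + 3 \<le> card ?U + blocks l + blocks r + blocks t\<close>, which is at most
      \<open>card ?U + blocks \<pi> + 3\<close>. Equality of the outer terms forces equality
      everywhere.\<close>
    using le blocks_glued[of l r t \<pi>] card_verts card_edges unfolding glue_table_def by auto
  also have "\<dots> \<longleftrightarrow> (l, r, t) \<in> glue_table \<pi> \<and> terminal_forest V1 w c d l T1 \<and>
        terminal_forest V2 c a m r T2 \<and> terminal_forest V3 d m b t T3"
    unfolding terminal_forest_def using ind by blast
  also have "\<dots> \<longleftrightarrow> ?R" (is "?M \<longleftrightarrow> _")
  proof
    assume ?M
    then show ?R by (intro bexI[of _ "(l, r, t)"]) simp_all
  next
    assume ?R
    then obtain l' r' t' where R: "(l', r', t') \<in> glue_table \<pi>" "terminal_forest V1 w c d l' T1"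
      "terminal_forest V2 c a m r' T2" "terminal_forest V3 d m b t' T3" by auto
    then have "induces T1 w c d l'" "induces T2 c a m r'" "induces T3 d m b t'"
      by (simp_all add: terminal_forest_def)
    then have "l' = l" "r' = r" "t' = t"
      using ind by (simp_all add: induces_unique)
    with R show ?M by simp
  qed
  finally show ?thesis .
qed

end

end

section \<open>Counting forests of the gasket\<close>

lemma finite_SG_verts [simp]: "finite (SG_verts n)"
  by (induction n) auto

lemma edges_on_SG: "T \<subseteq> SG_edges n \<Longrightarrow> edges_on (SG_verts n) T"
  using SG_edges_wf unfolding edges_on_def by blast

lemma finite_SG_edges [simp]: "finite (SG_edges n)"
  using edges_on_finite[OF edges_on_SG[OF subset_refl]] by simp

lemma inj_translate: "inj (translate x)"
  by (auto simp: inj_def translate_def prod_eq_iff)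

lemma edges_on_image:
  assumes "inj f" "edges_on V T"
  shows "edges_on (f ` V) ((`) f ` T)"
  using assms(2) card_image[OF inj_on_subset[OF assms(1) subset_UNIV]]
  unfolding edges_on_def by auto

text \<open>The predicate P restricts the degree at o; the trivial predicate gives the total numbers.\<close>

definition SG_forests :: "nat \<Rightarrow> tpart \<Rightarrow> (nat \<Rightarrow> bool) \<Rightarrow> point set set set" where
  "SG_forests n \<pi> P = {T. T \<subseteq> SG_edges n \<and>
     terminal_forest (SG_verts n) SG_o (SG_a n) (SG_b n) \<pi> T \<and> P (degree_in T SG_o)}"

lemma spanning_trees_SG:
  "{T \<in> spanning_trees (SG_verts n) (SG_edges n). P (degree_in T SG_o)} = SG_forests n P123 P"
  unfolding spanning_trees_def SG_forests_def
  using graph_tree_iff_terminal_forest[OF finite_SG_verts SG_corners edges_on_SG] by blast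

lemma translate_corners:
  "translate (SG_a n) SG_o = SG_a n" "translate (SG_a n) (SG_a n) = SG_a (Suc n)"
  "translate (SG_b n) SG_o = SG_b n" "translate (SG_b n) (SG_a n) = translate (SG_a n) (SG_b n)"
  "translate (SG_b n) (SG_b n) = SG_b (Suc n)"
  by (simp_all add: SG_a_def SG_b_def SG_o_def translate_def)

interpretation SG: triangle_gluing "SG_verts n" "translate (SG_a n) ` SG_verts n"
    "translate (SG_b n) ` SG_verts n" SG_o "SG_a (Suc n)" "SG_b (Suc n)" "SG_a n" "SG_b n"
    "translate (SG_a n) (SG_b n)" for n
proof
  show "SG_a (Suc n) \<in> translate (SG_a n) ` SG_verts n" "SG_b (Suc n) \<in> translate (SG_b n) ` SG_verts n"
    using SG_corners translate_corners by (metis imageI)+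
  show "distinct [SG_o, SG_a (Suc n), SG_b (Suc n), SG_a n, SG_b n, translate (SG_a n) (SG_b n)]"
    by (simp add: SG_a_def SG_b_def SG_o_def translate_def)
qed (simp_all add: SG_glue_left_right(1) SG_glue_left_top(1) SG_glue_right_top(1) SG_corners)

section \<open>Forests of SG(n + 1) as triples of forests of SG(n)\<close>

definition SG_join :: "nat \<Rightarrow> point set set \<times> point set set \<times> point set set \<Rightarrow> point set set" where
  "SG_join n = (\<lambda>(T1, T2, T3). T1 \<union> (`) (translate (SG_a n)) ` T2 \<union> (`) (translate (SG_b n)) ` T3)"

lemma edges_on_SG_parts:
  assumes "T1 \<subseteq> SG_edges n" "T2 \<subseteq> SG_edges n" "T3 \<subseteq> SG_edges n"
  shows "edges_on (SG_verts n) T1"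
    "edges_on (translate (SG_a n) ` SG_verts n) ((`) (translate (SG_a n)) ` T2)"
    "edges_on (translate (SG_b n) ` SG_verts n) ((`) (translate (SG_b n)) ` T3)"
  using assms by (simp_all add: edges_on_SG edges_on_image inj_translate)

text \<open>The copies of the edge set are disjoint, so each part is recovered from the union by
  intersecting with its copy.\<close>

lemma inj_on_SG_join:
  "inj_on (SG_join n) (Pow (SG_edges n) \<times> Pow (SG_edges n) \<times> Pow (SG_edges n))"
proof (rule inj_onI)
  fix x y assume xy: "x \<in> Pow (SG_edges n) \<times> Pow (SG_edges n) \<times> Pow (SG_edges n)"
    "y \<in> Pow (SG_edges n) \<times> Pow (SG_edges n) \<times> Pow (SG_edges n)" "SG_join n x = SG_join n y"
  obtain S1 S2 S3 T1 T2 T3 where e: "x = (S1, S2, S3)" "y = (T1, T2, T3)" by (metis prod_cases3)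
  let ?E = "SG_edges n" let ?A = "(`) (translate (SG_a n))" let ?B = "(`) (translate (SG_b n))"
  have d: "?E \<inter> ?A ` ?E = {}" "?E \<inter> ?B ` ?E = {}" "?A ` ?E \<inter> ?B ` ?E = {}"
    using SG.edges_disjoint[OF edges_on_SG_parts[of ?E n ?E ?E]] by simp_all
  have i: "inj ?A" "inj ?B" by (simp_all add: inj_def inj_image_eq_iff[OF inj_translate])
  have s: "S1 \<subseteq> ?E" "T1 \<subseteq> ?E" "?A ` S2 \<subseteq> ?A ` ?E" "?A ` T2 \<subseteq> ?A ` ?E"
    "?B ` S3 \<subseteq> ?B ` ?E" "?B ` T3 \<subseteq> ?B ` ?E" using xy(1,2) e by auto
  have eq: "S1 \<union> ?A ` S2 \<union> ?B ` S3 = T1 \<union> ?A ` T2 \<union> ?B ` T3"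
    using xy(3) e by (simp add: SG_join_def)
  have part: "X1 = (X1 \<union> X2 \<union> X3) \<inter> E1 \<and> X2 = (X1 \<union> X2 \<union> X3) \<inter> E2 \<and> X3 = (X1 \<union> X2 \<union> X3) \<inter> E3"
    if "X1 \<subseteq> E1" "X2 \<subseteq> E2" "X3 \<subseteq> E3" "E1 \<inter> E2 = {}" "E1 \<inter> E3 = {}" "E2 \<inter> E3 = {}"
    for X1 X2 X3 E1 E2 E3 :: "point set set"
    using that by blast
  have "S1 = T1" "?A ` S2 = ?A ` T2" "?B ` S3 = ?B ` T3"
    using part[OF s(1,3,5) d] part[OF s(2,4,6) d] unfolding eq by simp_all
  then show "x = y" using i e by (simp add: inj_image_eq_iff)
qed

text \<open>\<open>SG_o\<close> lies in neither translated copy, so a condition on its degree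
  concerns \<open>T1\<close> alone.\<close>

lemma degree_in_SG_join:
  assumes "T1 \<subseteq> SG_edges n" "T2 \<subseteq> SG_edges n" "T3 \<subseteq> SG_edges n"
  shows "degree_in (SG_join n (T1, T2, T3)) SG_o = degree_in T1 SG_o"
proof -
  have "SG_o \<notin> e" if "e \<in> (`) (translate (SG_a n)) ` T2" for e
    using that edges_on_SG_parts(2)[OF assms] SG.terminals_notin(1)[of n] by (auto simp: edges_on_def)
  moreover have "SG_o \<notin> e" if "e \<in> (`) (translate (SG_b n)) ` T3" for e
    using that edges_on_SG_parts(3)[OF assms] SG.terminals_notin(2)[of n] by (auto simp: edges_on_def)
  ultimately have "{e \<in> SG_join n (T1, T2, T3). SG_o \<in> e} = {e \<in> T1. SG_o \<in> e}"
    unfolding SG_join_def by auto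
  then show ?thesis by (simp add: degree_in_def)
qed

lemma SG_edges_Suc: "SG_edges (Suc n) = SG_join n (SG_edges n, SG_edges n, SG_edges n)"
  by (simp add: SG_join_def)

lemma SG_subset_joinE:
  assumes "T \<subseteq> SG_edges (Suc n)"
  obtains T1 T2 T3 where "T = SG_join n (T1, T2, T3)"
    "T1 \<subseteq> SG_edges n" "T2 \<subseteq> SG_edges n" "T3 \<subseteq> SG_edges n"
proof -
  let ?A = "(`) (translate (SG_a n))" let ?B = "(`) (translate (SG_b n))"
  have "T = SG_join n (T \<inter> SG_edges n, {e \<in> SG_edges n. ?A e \<in> T}, {e \<in> SG_edges n. ?B e \<in> T})"
    using assms by (auto simp: SG_join_def)
  then show ?thesis by (rule that) auto
qed

lemma terminal_forest_SG_join:
  assumes "T1 \<subseteq> SG_edges n" "T2 \<subseteq> SG_edges n" "T3 \<subseteq> SG_edges n"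
  defines "tf \<equiv> terminal_forest (SG_verts n) SG_o (SG_a n) (SG_b n)"
  shows "terminal_forest (SG_verts (Suc n)) SG_o (SG_a (Suc n)) (SG_b (Suc n)) \<pi> (SG_join n (T1, T2, T3))
    \<longleftrightarrow> (\<exists>(l, r, t) \<in> glue_table \<pi>. tf l T1 \<and> tf r T2 \<and> tf t T3)"
proof -
  have "terminal_forest (translate (SG_a n) ` SG_verts n) (SG_a n) (SG_a (Suc n))
      (translate (SG_a n) (SG_b n)) r ((`) (translate (SG_a n)) ` T2) \<longleftrightarrow> tf r T2" for r
    using terminal_forest_image[OF inj_translate, of "SG_a n" "SG_verts n" SG_o "SG_a n" "SG_b n"]
    by (simp add: translate_corners tf_def)
  moreover have "terminal_forest (translate (SG_b n) ` SG_verts n) (SG_b n)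
      (translate (SG_a n) (SG_b n)) (SG_b (Suc n)) t ((`) (translate (SG_b n)) ` T3) \<longleftrightarrow> tf t T3" for t
    using terminal_forest_image[OF inj_translate, of "SG_b n" "SG_verts n" SG_o "SG_a n" "SG_b n"]
    by (simp add: translate_corners tf_def)
  ultimately show ?thesis
    using SG.terminal_forest_glued[OF edges_on_SG_parts[OF assms(1-3)], of \<pi>]
    by (simp add: SG_join_def tf_def)
qed

lemma SG_forests_Suc:
  "SG_forests (Suc n) \<pi> P = SG_join n ` (\<Union>(l, r, t) \<in> glue_table \<pi>.
     SG_forests n l P \<times> SG_forests n r (\<lambda>_. True) \<times> SG_forests n t (\<lambda>_. True))" (is "?L = ?R")
proof (intro set_eqI iffI)
  fix T assume T: "T \<in> ?L"
  then have "T \<subseteq> SG_edges (Suc n)" by (simp add: SG_forests_def)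
  then obtain T1 T2 T3 where J: "T = SG_join n (T1, T2, T3)"
    and s: "T1 \<subseteq> SG_edges n" "T2 \<subseteq> SG_edges n" "T3 \<subseteq> SG_edges n" by (rule SG_subset_joinE)
  have "terminal_forest (SG_verts (Suc n)) SG_o (SG_a (Suc n)) (SG_b (Suc n)) \<pi> (SG_join n (T1, T2, T3))"
    "P (degree_in T1 SG_o)"
    using T J degree_in_SG_join[OF s] by (simp_all add: SG_forests_def)
  then show "T \<in> ?R"
    unfolding terminal_forest_SG_join[OF s] J SG_forests_def using s by (intro imageI) fastforce
next
  fix T assume "T \<in> ?R"
  then obtain l r t T1 T2 T3 where J: "T = SG_join n (T1, T2, T3)" and tab: "(l, r, t) \<in> glue_table \<pi>"
    and F: "T1 \<in> SG_forests n l P" "T2 \<in> SG_forests n r (\<lambda>_. True)" "T3 \<in> SG_forests n t (\<lambda>_. True)"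
    by auto
  then have s: "T1 \<subseteq> SG_edges n" "T2 \<subseteq> SG_edges n" "T3 \<subseteq> SG_edges n"
    by (simp_all add: SG_forests_def)
  have "terminal_forest (SG_verts (Suc n)) SG_o (SG_a (Suc n)) (SG_b (Suc n)) \<pi> T"
    unfolding terminal_forest_SG_join[OF s] J
    using tab F unfolding SG_forests_def by (intro bexI[of _ "(l, r, t)"]) simp_all
  moreover have "T \<subseteq> SG_edges (Suc n)"
    using s unfolding J SG_edges_Suc by (auto simp: SG_join_def)
  ultimately show "T \<in> ?L"
    using F(1) degree_in_SG_join[OF s] by (simp add: SG_forests_def J)
qed

definition SG_count :: "nat \<Rightarrow> tpart \<Rightarrow> (nat \<Rightarrow> bool) \<Rightarrow> real" where
  "SG_count n \<pi> P = real (card (SG_forests n \<pi> P))"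

lemma finite_SG_forests: "finite (SG_forests n \<pi> P)"
  by (rule finite_subset[of _ "Pow (SG_edges n)"]) (auto simp: SG_forests_def)

lemma finite_glue_table: "finite (glue_table \<pi>)"
  by (cases \<pi>) (simp_all add: glue_table)

text \<open>A forest induces only one partition, so the products for different entries of the table
  are disjoint and their cardinalities add up.\<close>

lemma SG_count_Suc:
  "SG_count (Suc n) \<pi> P = (\<Sum>(l, r, t) \<in> glue_table \<pi>.
     SG_count n l P * SG_count n r (\<lambda>_. True) * SG_count n t (\<lambda>_. True))"
proof -
  let ?F = "\<lambda>(l, r, t). SG_forests n l P \<times> SG_forests n r (\<lambda>_. True) \<times> SG_forests n t (\<lambda>_. True)"
  have inj: "inj_on (SG_join n) (\<Union>(?F ` glue_table \<pi>))"
    by (rule inj_on_subset[OF inj_on_SG_join]) (auto simp: SG_forests_def)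
  have uniq: "\<rho> = \<sigma>" if "T \<in> SG_forests n \<rho> Q" "T \<in> SG_forests n \<sigma> Q'" for T \<rho> \<sigma> Q Q'
    by (rule induces_unique[of T SG_o "SG_a n" "SG_b n"])
      (use that in \<open>simp_all add: SG_forests_def terminal_forest_def\<close>)
  have dis: "?F x \<inter> ?F y = {}" if "x \<noteq> y" for x y
    using that uniq by (cases x; cases y) fastforce
  have "card (SG_forests (Suc n) \<pi> P) = card (\<Union>(?F ` glue_table \<pi>))"
    unfolding SG_forests_Suc by (rule card_image[OF inj])
  also have "\<dots> = (\<Sum>x \<in> glue_table \<pi>. card (?F x))"
    by (rule card_UN_disjoint) (auto simp: finite_glue_table finite_SG_forests dis split: prod.split)
  finally show ?thesis
    by (simp add: SG_count_def card_cartesian_product case_prod_beta mult.assoc)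
qed

section \<open>The initial triangle SG(0)\<close>

lemma conn_triangle:
  assumes "T \<subseteq> {{p, q}, {p, r}, {q, r}}" "distinct [p, q, r]"
  shows "conn T p q \<longleftrightarrow> {p, q} \<in> T \<or> {p, r} \<in> T \<and> {q, r} \<in> T"
proof
  assume c: "conn T p q"
  show "{p, q} \<in> T \<or> {p, r} \<in> T \<and> {q, r} \<in> T"
  proof (rule ccontr)
    assume n: "\<not> ?thesis"
    \<comment> \<open>With the edge between \<open>p\<close> and \<open>q\<close> absent, this
      colouring marks \<open>p\<close>, and also \<open>r\<close> if it is adjacent to
      \<open>p\<close>; it separates \<open>p\<close> from \<open>q\<close>.\<close>
    have "(u = p \<or> u = r \<and> {p, r} \<in> T) = (v = p \<or> v = r \<and> {p, r} \<in> T)" if "{u, v} \<in> T" for u v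
    proof -
      from that assms have "{u, v} = {p, r} \<or> {u, v} = {q, r}" using n by auto
      then show ?thesis using n that assms(2) by (auto simp: doubleton_eq_iff insert_commute)
    qed
    then show False
      using c[unfolded conn_def, rule_format, of "\<lambda>u. u = p \<or> u = r \<and> {p, r} \<in> T"] assms(2) by auto
  qed
next
  assume "{p, q} \<in> T \<or> {p, r} \<in> T \<and> {q, r} \<in> T"
  then show "conn T p q"
    using conn_edge conn_trans conn_sym by metis
qed

lemma filter_insert:
  "{x \<in> insert a A. Q x} = (if Q a then {a} else {}) \<union> {x \<in> A. Q x}"
  by auto

lemma SG_count_0:
  "SG_count 0 P123 P = 2 * of_bool (P 1) + of_bool (P 2)" "SG_count 0 P1_23 P = of_bool (P 0)"
  "SG_count 0 P2_13 P = of_bool (P 1)" "SG_count 0 P3_12 P = of_bool (P 1)"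
  "SG_count 0 P1_2_3 P = of_bool (P 0)"
proof -
  define pq pr qr where "pq = {SG_o, SG_a 0}" and "pr = {SG_o, SG_b 0}" and "qr = {SG_a 0, SG_b 0}"
  note defs = pq_def pr_def qr_def
  have ne: "SG_o \<noteq> SG_a 0" "SG_o \<noteq> SG_b 0" "SG_a 0 \<noteq> SG_b 0"
    by (simp_all add: SG_o_def SG_a_def SG_b_def)
  then have e: "pq \<noteq> pr" "pq \<noteq> qr" "pr \<noteq> qr" by (auto simp: defs doubleton_eq_iff)
  define good where "good = terminal_forest (SG_verts 0) SG_o (SG_a 0) (SG_b 0)"
  have tf: "good \<pi> T \<longleftrightarrow>
      (pq \<in> T \<or> pr \<in> T \<and> qr \<in> T) = join12 \<pi> \<and> (pr \<in> T \<or> pq \<in> T \<and> qr \<in> T) = join13 \<pi> \<and>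
      (qr \<in> T \<or> pq \<in> T \<and> pr \<in> T) = join23 \<pi> \<and> card T + blocks \<pi> = 3"
    if T: "T \<subseteq> {pq, pr, qr}" for T \<pi>
  proof -
    have "conn T SG_o (SG_a 0) \<longleftrightarrow> pq \<in> T \<or> pr \<in> T \<and> qr \<in> T"
      using conn_triangle[of T SG_o "SG_a 0" "SG_b 0"] T ne by (simp add: defs)
    moreover have "conn T SG_o (SG_b 0) \<longleftrightarrow> pr \<in> T \<or> pq \<in> T \<and> qr \<in> T"
      using conn_triangle[of T SG_o "SG_b 0" "SG_a 0"] T ne by (simp add: defs insert_commute)
    moreover have "conn T (SG_a 0) (SG_b 0) \<longleftrightarrow> qr \<in> T \<or> pq \<in> T \<and> pr \<in> T"
      using conn_triangle[of T "SG_a 0" "SG_b 0" SG_o] T ne by (simp add: defs insert_commute)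
    moreover have "covered (SG_verts 0) T SG_o (SG_a 0) (SG_b 0)" by (auto simp: covered_def)
    moreover have "card (SG_verts 0) = 3" using ne by simp
    ultimately show ?thesis unfolding good_def terminal_forest_def induces_def by simp
  qed
  have F: "SG_forests 0 \<pi> P = {T \<in> Pow {pq, pr, qr}.
      good \<pi> T \<and> P (degree_in T SG_o)}" for \<pi>
    by (simp add: SG_forests_def defs good_def)
  have Pow: "Pow {pq, pr, qr} = {{}, {pq}, {pr}, {qr}, {pq, pr}, {pq, qr}, {pr, qr}, {pq, pr, qr}}"
    by (auto simp: Pow_insert)
  have o: "SG_o \<in> pq" "SG_o \<in> pr" "SG_o \<notin> qr" using ne by (auto simp: defs)
  \<comment> \<open>The full triangle is never counted, since its three edges exceed
    \<open>3 - blocks \<pi>\<close>.\<close>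
  have deg: "degree_in {} SG_o = 0" "degree_in {pq} SG_o = 1" "degree_in {pr} SG_o = 1"
    "degree_in {qr} SG_o = 0" "degree_in {pq, pr} SG_o = 2" "degree_in {pq, qr} SG_o = 1"
    "degree_in {pr, qr} SG_o = 1"
    unfolding degree_in_def filter_insert using o e by simp_all
  show "SG_count 0 P123 P = 2 * of_bool (P 1) + of_bool (P 2)"
    "SG_count 0 P1_23 P = of_bool (P 0)" "SG_count 0 P2_13 P = of_bool (P 1)"
    "SG_count 0 P3_12 P = of_bool (P 1)" "SG_count 0 P1_2_3 P = of_bool (P 0)"
    unfolding SG_count_def F Pow filter_insert
    by (simp_all add: tf e e[symmetric] join12_def join13_def join23_def deg doubleton_eq_iff)
qed

section \<open>Closed forms and the limit\<close>

definition tree_count :: "nat \<Rightarrow> real" where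
  "tree_count n = 2 powr SG_alpha n * 3 powr SG_beta n * 5 powr SG_gamma n"

text \<open>The quotient of the numbers of forests with two prescribed blocks and of spanning trees.\<close>

definition tree_ratio :: "nat \<Rightarrow> real" where
  "tree_ratio n = (5 / 3) ^ n / 3"

lemma tree_count_pos: "tree_count n > 0"
  by (simp add: tree_count_def)

lemma tree_count_0: "tree_count 0 = 3"
  by (simp add: tree_count_def SG_alpha_def SG_beta_def SG_gamma_def)

lemma tree_ratio_Suc: "tree_ratio (Suc n) = 5 / 3 * tree_ratio n"
  by (simp add: tree_ratio_def)

text \<open>Compared with a cube, the exponent of 3 drops by \<open>n\<close> and that of 5 grows by
  \<open>n\<close>, which is the factor \<open>(5 / 3) ^ n\<close> of \<open>tree_ratio n\<close>.
  The remaining factor 6 / 3 = 2 comes from \<open>SG_alpha\<close>.\<close>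

lemma tree_count_Suc: "tree_count (Suc n) = 6 * tree_count n ^ 3 * tree_ratio n"
proof -
  have "SG_alpha (Suc n) = 3 * SG_alpha n + 1" "SG_beta (Suc n) = 3 * SG_beta n - real n"
    "SG_gamma (Suc n) = 3 * SG_gamma n + real n"
    by (simp_all add: SG_alpha_def SG_beta_def SG_gamma_def field_simps)
  moreover have "x powr (3 * y) = (x powr y) ^ 3" if "x > 0" for x y :: real
    using that by (simp add: powr_power mult.commute)
  ultimately show ?thesis
    by (simp add: tree_count_def tree_ratio_def powr_add powr_diff powr_realpow power_divide
        power_mult_distrib)
qed

text \<open>Write f and q for \<open>tree_count n\<close> and \<open>tree_ratio n\<close>. The table
  yields 6 f^3 q for one block, (7 + 3) f^3 q^2 for each two-block partition and (14 + 12 * 3) f^3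
  q^3 for three blocks; triples with an entry \<open>P1_2_3\<close> have weight 3. The ratio 10 / 6
  is the growth factor 5 / 3 of q.\<close>

lemma SG_count_total:
  "SG_count n P123 (\<lambda>_. True) = tree_count n"
  "SG_count n P1_23 (\<lambda>_. True) = tree_count n * tree_ratio n"
  "SG_count n P2_13 (\<lambda>_. True) = tree_count n * tree_ratio n"
  "SG_count n P3_12 (\<lambda>_. True) = tree_count n * tree_ratio n"
  "SG_count n P1_2_3 (\<lambda>_. True) = 3 * tree_count n * tree_ratio n ^ 2"
proof (induction n)
  case 0
  {
    case 1 show ?case by (simp add: SG_count_0 tree_count_0 tree_ratio_def)
  next
    case 2 show ?case by (simp add: SG_count_0 tree_count_0 tree_ratio_def)
  next
    case 3 show ?case by (simp add: SG_count_0 tree_count_0 tree_ratio_def)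
  next
    case 4 show ?case by (simp add: SG_count_0 tree_count_0 tree_ratio_def)
  next
    case 5 show ?case by (simp add: SG_count_0 tree_count_0 tree_ratio_def power2_eq_square)
  }
next
  case (Suc n)
  note s = SG_count_Suc glue_table Suc.IH tree_count_Suc tree_ratio_Suc power2_eq_square power3_eq_cube
    algebra_simps
  {
    case 1 show ?case by (simp add: s)
  next
    case 2 show ?case by (simp add: s)
  next
    case 3 show ?case by (simp add: s)
  next
    case 4 show ?case by (simp add: s)
  next
    case 5 show ?case by (simp add: s)
  }
qed

text \<open>Let x, y, z be the refined numbers for \<open>P123\<close>, \<open>P2_13\<close>,
  \<open>P3_12\<close> divided by the total ones. The table gives x' = (4x + y + z) / 6 and y' = (6x
  + 3y + z) / 10, and symmetrically for z'. For y = z the eigenvalues are 1 and 1/15 with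
  eigenvectors (1, 1) and (-5, 9); \<open>A\<close> and \<open>B\<close> are the coordinates of the
  initial vector.\<close>

lemma SG_count_refined:
  assumes "SG_count 0 P123 P = 3 * (A - 5 * B)"
    "SG_count 0 P2_13 P = A + 9 * B" "SG_count 0 P3_12 P = A + 9 * B"
  shows "SG_count n P123 P = tree_count n * (A - 5 * B * (1 / 15) ^ n)"
    "SG_count n P2_13 P = tree_count n * tree_ratio n * (A + 9 * B * (1 / 15) ^ n)"
    "SG_count n P3_12 P = tree_count n * tree_ratio n * (A + 9 * B * (1 / 15) ^ n)"
proof (induction n)
  case 0
  {
    case 1 show ?case using assms by (simp add: tree_count_0 tree_ratio_def)
  next
    case 2 show ?case using assms by (simp add: tree_count_0 tree_ratio_def)
  next
    case 3 show ?case using assms by (simp add: tree_count_0 tree_ratio_def)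
  }
next
  case (Suc n)
  note s = SG_count_Suc glue_table Suc.IH SG_count_total tree_count_Suc tree_ratio_Suc
    power2_eq_square power3_eq_cube power_Suc
  {
    case 1 show ?case by (simp add: s) (simp add: algebra_simps)
  next
    case 2 show ?case by (simp add: s) (simp add: algebra_simps)
  next
    case 3 show ?case by (simp add: s) (simp add: algebra_simps)
  }
qed

lemma SG_fdeg_count: "real (SG_fdeg j n SG_o) = SG_count n P123 (\<lambda>k. k = j)"
  using spanning_trees_SG[of n "\<lambda>k. k = j"] by (simp add: SG_fdeg_def SG_count_def)

lemma SG_f_count: "real (SG_f n) = SG_count n P123 (\<lambda>_. True)"
  using spanning_trees_SG[of n "\<lambda>_. True"] by (simp add: SG_f_def SG_count_def)

theorem mainTheorem3:
  shows "(\<forall>n::nat.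
            real (SG_fdeg 1 n SG_o)
              = (11 / 14 - 5 / 42 * (1 / 15) ^ n)
                * (2 powr SG_alpha n * 3 powr SG_beta n * 5 powr SG_gamma n)
          \<and> real (SG_fdeg 2 n SG_o)
              = (3 / 14 + 5 / 42 * (1 / 15) ^ n)
                * (2 powr SG_alpha n * 3 powr SG_beta n * 5 powr SG_gamma n))
       \<and> (\<lambda>n. SG_Fdeg 1 n SG_o) \<longlonglongrightarrow> 11 / 14
       \<and> (\<lambda>n. SG_Fdeg 2 n SG_o) \<longlonglongrightarrow> 3 / 14"
proof -
  have f1: "real (SG_fdeg 1 n SG_o) = (11 / 14 - 5 / 42 * (1 / 15) ^ n) * tree_count n" for n
    \<comment> \<open>In SG(0) two of the three spanning trees have degree 1 at o, as do both
      forests with blocks as in \<open>P2_13\<close> and \<open>P3_12\<close>. So (2/3, 1) = A (1,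
      1) + B (-5, 9).\<close>
    using SG_count_refined(1)[of "\<lambda>k. k = 1" "11 / 14" "1 / 42" n]
    by (simp add: SG_fdeg_count SG_count_0)
  have f2: "real (SG_fdeg 2 n SG_o) = (3 / 14 + 5 / 42 * (1 / 15) ^ n) * tree_count n" for n
    \<comment> \<open>Here the initial vector is (1/3, 0): one tree of the triangle has degree 2 at
      o, and no two-block forest has.\<close>
    using SG_count_refined(1)[of "\<lambda>k. k = 2" "3 / 14" "- 1 / 42" n]
    by (simp add: SG_fdeg_count SG_count_0)
  have F: "SG_Fdeg 1 n SG_o = 11 / 14 - 5 / 42 * (1 / 15) ^ n"
    "SG_Fdeg 2 n SG_o = 3 / 14 + 5 / 42 * (1 / 15) ^ n" for n
    using tree_count_pos[of n] by (simp_all add: SG_Fdeg_def f1[unfolded One_nat_def] f2 SG_f_count SG_count_total)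
  have lim: "(\<lambda>n. (1 / 15 :: real) ^ n) \<longlonglongrightarrow> 0"
    by (rule LIMSEQ_power_zero) simp
  have "(\<lambda>n. SG_Fdeg 1 n SG_o) \<longlonglongrightarrow> 11 / 14 - 5 / 42 * 0"
    unfolding F by (intro tendsto_intros lim)
  moreover have "(\<lambda>n. SG_Fdeg 2 n SG_o) \<longlonglongrightarrow> 3 / 14 + 5 / 42 * 0"
    unfolding F by (intro tendsto_intros lim)
  ultimately show ?thesis using f1 f2 unfolding tree_count_def by simp
qed

end
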